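(* Let $K$ be a quadratic number field, let $\chi$ be the Dirichlet character corresponding to the extension $K/\mathbf{Q}$, let $f\ge 1$ be an integer, let $p$ be a prime factor of $f$, and let $n_p\ge 1$ be the exact power (exponent) of $p$ in $f$, i.e. $p^{n_p}\mid f$ and $p^{n_p+1}\nmid f$. For $s\in\mathbf{C}$ put $$\varepsilon_{f,\,p}(s):=\frac{(1-p^{-s})(1-\chi(p)p^{-s})-p^{n_p-1-2n_ps}(1-p^{1-s})(\chi(p)-p^{1-s})}{1-p^{1-2s}}.$$ Then: 1) The function $\varepsilon_{f,\,p}(s)$ is a polynomial of degree $2n_p$ in $p^{-s}$ and satisfies the functional equation $$\varepsilon_{f,\,p}(1-s)=p^{-n_p(1-2s)}\,\varepsilon_{f,\,p}(s).$$ 2) All the zeros of $\varepsilon_{f,\,p}(s)$ lie on the line $\mathrm{Re}(s)=1/2$.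
   Context: The Dirichlet character $\chi$ corresponding to $K/\mathbf{Q}$ is the quadratic (Kronecker) character attached to the discriminant of $K$: for a prime $p$, $\chi(p)=1$, $-1$ or $0$ according to whether $p$ splits, is inert, or ramifies in $K$. The function $\varepsilon_{f,p}(s)$ is regarded as a function on all of $\mathbf{C}$: part 1) says that there is a polynomial $P(u)$ of degree $2n_p$ such that $\varepsilon_{f,p}(s)=P(p^{-s})$ wherever the denominator $1-p^{1-2s}$ is nonzero, and $\varepsilon_{f,p}(s)$ is understood as $P(p^{-s})$ at the (removable) points where the denominator vanishes. Zeros in part 2) are complex zeros $s$ of this function. Background (not needed for the statement): $\varepsilon_{f,p}(s)$ is the local factor at $p$ of $\zeta_{\mathcal{O}_f}(s)/\zeta_K(s)$, where $\zeta_K$ is the Dedekind zeta function of $K$, $\mathcal{O}_f$ is the order of conductor $f$ in the ring of integers of $K$, and $\zeta_{\mathcal{O}_f}(s)=\sum_{\mathfrak a}N(\mathfrak a)^{-s}$ is the sum over all proper ideals $\mathfrak a$ of $\mathcal{O}_f$ with norm $N(\mathfrak a)$. *)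

theory Defs
  imports
    "HOL-Complex_Analysis.Complex_Analysis"
    "HOL-Number_Theory.Number_Theory"
begin

section \<open>Quadratic number fields and their discriminant\<close>

text \<open>A number field is a type \<open>'a\<close> of class \<^class>\<open>field_char_0\<close>, regarded as a vector space
  over its prime field \<open>\<rat>\<close> (the scalars have type \<^typ>\<open>rat\<close>).\<close>

global_interpretation rat_vector:
  vector_space "\<lambda>(q :: rat) (x :: 'a :: field_char_0). of_rat q * x"
  by unfold_locales (simp_all add: of_rat_add of_rat_mult algebra_simps)

definition quadratic_field :: "'a :: field_char_0 itself \<Rightarrow> bool" where
  "quadratic_field K \<longleftrightarrow> rat_vector.dim (UNIV :: 'a set) = 2"

text \<open>The trace to \<open>\<rat>\<close>: the trace of the \<open>\<rat>\<close>-linear map \<open>y \<mapsto> x * y\<close>. It does not depend on the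
  chosen basis.\<close>

definition field_trace :: "'a :: field_char_0 \<Rightarrow> rat" where
  "field_trace x =
     (let B = (SOME B. rat_vector.independent B \<and> rat_vector.span B = UNIV)
      in \<Sum>b\<in>B. rat_vector.representation B (x * b) b)"

definition integral_basis :: "'a :: field_char_0 \<Rightarrow> 'a \<Rightarrow> bool" where
  "integral_basis w1 w2 \<longleftrightarrow>
     (\<forall>x. algebraic_int x \<longleftrightarrow> (\<exists>a b. x = of_int a * w1 + of_int b * w2)) \<and>
     (\<forall>a b. of_int a * w1 + of_int b * w2 = 0 \<longrightarrow> a = 0 \<and> b = 0)"

text \<open>Determinant of the trace form on a \<open>\<int>\<close>-basis of the ring of integers; this is
  meaningful only for quadratic fields.\<close>

definition quadratic_discriminant :: "'a :: field_char_0 itself \<Rightarrow> int" where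
  "quadratic_discriminant K =
     (THE D. \<exists>w1 w2 :: 'a. integral_basis w1 w2 \<and>
        of_int D = field_trace (w1 * w1) * field_trace (w2 * w2) - (field_trace (w1 * w2))\<^sup>2)"

section \<open>The Kronecker symbol and the character of a quadratic field\<close>

definition kronecker_prime :: "int \<Rightarrow> int \<Rightarrow> int" where
  "kronecker_prime a q =
     (if q = 2 then
        (if even a then 0 else if a mod 8 = 1 \<or> a mod 8 = 7 then 1 else -1)
      else Legendre a q)"

definition kronecker :: "int \<Rightarrow> int \<Rightarrow> int" where
  "kronecker a n =
     (if n = 0 then (if \<bar>a\<bar> = 1 then 1 else 0)
      else (if n < 0 \<and> a < 0 then -1 else 1) *
           (\<Prod>q\<in>prime_factors \<bar>n\<bar>. kronecker_prime a q ^ multiplicity q n))"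

definition quadratic_character :: "'a :: field_char_0 itself \<Rightarrow> int \<Rightarrow> int" where
  "quadratic_character K n = kronecker (quadratic_discriminant K) n"

section \<open>The local factor\<close>

text \<open>The defining quotient; at the zeros of the denominator it has the junk value \<open>0\<close>.\<close>

definition eps_quotient ::
    "'a :: field_char_0 itself \<Rightarrow> nat \<Rightarrow> nat \<Rightarrow> complex \<Rightarrow> complex" where
  "eps_quotient K f p s =
     (let P = of_nat p :: complex;
          c = of_int (quadratic_character K (int p));
          n = of_nat (multiplicity p f)
      in ((1 - P powr (-s)) * (1 - c * P powr (-s))
          - P powr (n - 1 - 2 * n * s) * (1 - P powr (1 - s)) * (c - P powr (1 - s)))
         / (1 - P powr (1 - 2 * s)))"

text \<open>The function on all of \<open>\<complex>\<close>: the removable singularities are filled in by the limits.\<close>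

definition eps ::
    "'a :: field_char_0 itself \<Rightarrow> nat \<Rightarrow> nat \<Rightarrow> complex \<Rightarrow> complex" where
  "eps K f p = remove_sings (eps_quotient K f p)"

end

theory Submission
  imports Defs
begin

text \<open>With \<open>u = p\<^sup>-\<^sup>s\<close>, \<open>c = \<chi>(p)\<close>, \<open>x = p u\<^sup>2\<close> and \<open>n = n\<^sub>p\<close>, the numerator is
  \<open>(1 - x\<^sup>n\<^sup>+\<^sup>1) - (1 + c) u (1 - x\<^sup>n) + c u\<^sup>2 (1 - x\<^sup>n\<^sup>-\<^sup>1)\<close>, so that dividing by \<open>1 - x\<close> leaves three
  geometric sums. The substitution \<open>s \<mapsto> 1 - s\<close> replaces \<open>u\<close> by \<open>1 / (p u)\<close> and \<open>x\<close> by \<open>1 / x\<close>,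
  which reverses these sums. For the zeros put \<open>v = u \<surd>p\<close> and \<open>a = 1 / \<surd>p\<close>: the numerator becomes
  \<open>(1 - a v) (1 - c a v) - v\<^sup>2\<^sup>n (v - a) (v - c a)\<close>. As \<open>a\<close> and \<open>c a\<close> are real and lie in the open
  unit disc, the first product is the larger one in modulus for \<open>|v| < 1\<close> and the smaller one
  for \<open>|v| > 1\<close>.\<close>

section \<open>The value of the character at a prime\<close>

text \<open>Makes \<open>c\<close> real with modulus at most 1, which puts \<open>c / sqrt p\<close>
  in the open unit disc.\<close>

lemma kronecker_prime_cases: "kronecker_prime a q \<in> {-1, 0, 1}"
  by (auto simp: kronecker_prime_def Legendre_def)

lemma kronecker_of_prime:
  fixes p :: nat
  assumes "prime p"
  shows "kronecker a (int p) = kronecker_prime a (int p)"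
proof -
  have p: "prime (int p)"
    using assms by simp
  have "prime_factors \<bar>int p\<bar> = {int p}"
    using prime_prime_factors[OF p] by simp
  moreover have "multiplicity (int p) (int p) = 1"
    using p by (simp add: prime_multiplicity_other)
  ultimately show ?thesis
    using assms by (simp add: kronecker_def prime_gt_0_nat)
qed

section \<open>The polynomial in \<open>u\<close>: degree and reflection\<close>

text \<open>The numerator divided by \<open>1 - x\<close>, with \<open>[:0, 0, q:]\<close> in the
  role of \<open>x\<close>. Geometric sums avoid the division, so the value also makes sense where
  \<open>x = 1\<close>.\<close>

definition local_poly :: "complex \<Rightarrow> complex \<Rightarrow> nat \<Rightarrow> complex poly" where
  "local_poly q c n =
     (\<Sum>i\<le>n. [:0, 0, q:] ^ i) - [:0, 1 + c:] * (\<Sum>i<n. [:0, 0, q:] ^ i)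
       + [:0, 0, c:] * (\<Sum>i<n-1. [:0, 0, q:] ^ i)"

lemma poly_local_poly:
  "poly (local_poly q c n) u =
     (\<Sum>i\<le>n. (q * u\<^sup>2) ^ i) - (1 + c) * u * (\<Sum>i<n. (q * u\<^sup>2) ^ i)
       + c * u\<^sup>2 * (\<Sum>i<n-1. (q * u\<^sup>2) ^ i)"
  by (simp add: local_poly_def poly_sum power2_eq_square algebra_simps)

text \<open>Only the last term of the first sum reaches degree \<open>2 * n\<close>; everything else
  is collected in \<open>Q\<close>, of smaller degree.\<close>

lemma degree_local_poly:
  assumes "q \<noteq> 0" "n \<ge> 1"
  shows "degree (local_poly q c n) = 2 * n"
proof -
  define X where "X = [:0, 0, q:]"
  have X: "degree (X ^ i) = 2 * i" for i
    using assms by (simp add: X_def degree_power_eq)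
  have S: "degree (\<Sum>i<m. X ^ i) \<le> 2 * (m - 1)" for m
    by (intro degree_sum_le) (auto simp: X)
  have "degree ([:0, 1 + c:] * (\<Sum>i<n. X ^ i)) \<le> 1 + 2 * (n - 1)"
    by (intro order.trans[OF degree_mult_le] add_mono S) simp
  then have d1: "degree ([:0, 1 + c:] * (\<Sum>i<n. X ^ i)) < 2 * n"
    using assms by linarith
  have d2: "degree ([:0, 0, c:] * (\<Sum>i<n-1. X ^ i)) < 2 * n"
  \<comment> \<open>For \<open>n = 1\<close> truncated subtraction would make the bound below equal
    to \<open>2 * n\<close>, which is not strict; but then the sum is empty.\<close>
  proof (cases "n = 1")
    case False
    have "degree ([:0, 0, c:] * (\<Sum>i<n-1. X ^ i)) \<le> 2 + 2 * (n - 1 - 1)"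
      by (intro order.trans[OF degree_mult_le] add_mono S) simp
    then show ?thesis
      using False assms by linarith
  qed simp
  have d0: "degree (\<Sum>i<n. X ^ i) < 2 * n"
    using S[of n] assms by linarith
  define Q where "Q = (\<Sum>i<n. X ^ i) - [:0, 1 + c:] * (\<Sum>i<n. X ^ i)
      + [:0, 0, c:] * (\<Sum>i<n-1. X ^ i)"
  have "degree Q < 2 * n"
    unfolding Q_def by (intro degree_add_less degree_diff_less d0 d1 d2)
  moreover have "local_poly q c n = Q + X ^ n"
    by (simp add: local_poly_def Q_def X_def flip: lessThan_Suc_atMost)
  ultimately show ?thesis
    using X[of n] by (simp add: degree_add_eq_right)
qed

text \<open>Telescoping of the three geometric sums. With \<open>q = p\<close>, the factor
  \<open>(q * u\<^sup>2) ^ n / q\<close> is the power of \<open>p\<close> with exponent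
  \<open>n - 1 - 2 * n * s\<close>, so the right side is the numerator of the local factor.\<close>

lemma local_poly_times_denominator:
  assumes "q \<noteq> 0" "n \<ge> 1"
  shows "(1 - q * u\<^sup>2) * poly (local_poly q c n) u =
    (1 - u) * (1 - c * u) - (q * u\<^sup>2) ^ n / q * (1 - q * u) * (c - q * u)"
proof -
  define x where "x = q * u\<^sup>2"
  obtain m where n: "n = Suc m"
    using assms(2) by (cases n) auto
  have geo: "(1 - x) * (\<Sum>i<k. x ^ i) = 1 - x ^ k" for k
    by (rule one_diff_power_eq[symmetric])
  have "(1 - x) * poly (local_poly q c n) u =
      (1 - x) * (\<Sum>i<Suc n. x ^ i) - (1 + c) * u * ((1 - x) * (\<Sum>i<n. x ^ i))
        + c * u\<^sup>2 * ((1 - x) * (\<Sum>i<n-1. x ^ i))"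
    unfolding poly_local_poly x_def[symmetric] lessThan_Suc_atMost
    by (simp add: algebra_simps del: sum.lessThan_Suc sum.atMost_Suc)
  also have "\<dots> = (1 - x ^ Suc n) - (1 + c) * u * (1 - x ^ n) + c * u\<^sup>2 * (1 - x ^ m)"
    unfolding geo by (simp add: n)
  also have "\<dots> = (1 - u) * (1 - c * u) - u\<^sup>2 * x ^ m * (1 - q * u) * (c - q * u)"
    by (simp add: n x_def algebra_simps power2_eq_square)
  also have "u\<^sup>2 * x ^ m = x ^ n / q"
    using assms by (simp add: n x_def)
  finally show ?thesis
    by (simp add: x_def)
qed

lemma power_sum_inverse:
  fixes x :: "'a :: field"
  assumes "x \<noteq> 0"
  shows "x ^ n * (\<Sum>i\<le>n. inverse x ^ i) = (\<Sum>i\<le>n. x ^ i)"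
proof -
  have "x ^ n * (\<Sum>i\<le>n. inverse x ^ i) = (\<Sum>i\<le>n. x ^ (n - i))"
    unfolding sum_distrib_left using assms
    by (intro sum.cong) (auto simp: power_diff power_inverse divide_inverse)
  also have "\<dots> = (\<Sum>i\<le>n. x ^ i)"
    by (rule sum.nat_diff_reindex[of "\<lambda>i. x ^ i" "Suc n", unfolded lessThan_Suc_atMost, simplified])
  finally show ?thesis .
qed

text \<open>Each of the three terms is invariant by itself. Reversing the sums uses up
  \<open>x ^ n\<close>, \<open>x ^ (n-1)\<close> and \<open>x ^ (n-2)\<close>; the leftover powers
  of \<open>x\<close> turn \<open>w\<close> into \<open>u\<close> and \<open>w\<^sup>2\<close> into
  \<open>u\<^sup>2\<close>, because \<open>x * w = u\<close>.\<close>

lemma local_poly_reflect: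
  assumes "q \<noteq> 0" "u \<noteq> 0" "n \<ge> 1"
  shows "(q * u\<^sup>2) ^ n * poly (local_poly q c n) (1 / (q * u)) = poly (local_poly q c n) u"
proof -
  define x where "x = q * u\<^sup>2"
  define w where "w = 1 / (q * u)"
  have x0: "x \<noteq> 0"
    using assms by (simp add: x_def)
  have xinv: "q * w\<^sup>2 = inverse x"
    using assms by (simp add: x_def w_def field_simps power2_eq_square)
  have xw: "x * w = u"
    using assms by (simp add: x_def w_def field_simps power2_eq_square)
  have B: "w * (x ^ n * (\<Sum>i<n. inverse x ^ i)) = u * (\<Sum>i<n. x ^ i)"
  proof -
    obtain m where n: "n = Suc m"
      using assms(3) by (cases n) auto
    have "w * (x ^ n * (\<Sum>i<n. inverse x ^ i)) = (x * w) * (x ^ m * (\<Sum>i\<le>m. inverse x ^ i))"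
      by (simp add: n lessThan_Suc_atMost)
    then show ?thesis
      unfolding power_sum_inverse[OF x0] xw by (simp add: n lessThan_Suc_atMost)
  qed
  have C: "w\<^sup>2 * (x ^ n * (\<Sum>i<n-1. inverse x ^ i)) = u\<^sup>2 * (\<Sum>i<n-1. x ^ i)"
  proof (cases "n = 1")
    case False
    define m where "m = n - 2"
    with False have n: "n = Suc (Suc m)"
      using assms(3) by linarith
    have "w\<^sup>2 * (x ^ n * (\<Sum>i<n-1. inverse x ^ i))
        = (x * w)\<^sup>2 * (x ^ m * (\<Sum>i\<le>m. inverse x ^ i))"
      by (simp add: n lessThan_Suc_atMost power2_eq_square)
    then show ?thesis
      unfolding power_sum_inverse[OF x0] xw by (simp add: n lessThan_Suc_atMost)
  qed simp
  have "x ^ n * poly (local_poly q c n) w = x ^ n * (\<Sum>i\<le>n. inverse x ^ i)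
      - (1 + c) * (w * (x ^ n * (\<Sum>i<n. inverse x ^ i)))
      + c * (w\<^sup>2 * (x ^ n * (\<Sum>i<n-1. inverse x ^ i)))"
    unfolding poly_local_poly xinv by (simp only: ring_distribs ac_simps)
  also have "\<dots> = poly (local_poly q c n) u"
    unfolding power_sum_inverse[OF x0] B C poly_local_poly x_def[symmetric] by simp
  finally show ?thesis
    by (simp add: x_def w_def)
qed

section \<open>Location of the roots\<close>

text \<open>Since \<open>a\<close> is real, both squared norms contain the same cross term
  \<open>- 2 * a * Re v\<close>, which cancels.\<close>

lemma norm_blaschke_diff:
  fixes a :: real and v :: complex
  shows "(norm (1 - of_real a * v))\<^sup>2 - (norm (v - of_real a))\<^sup>2 = (1 - a\<^sup>2) * (1 - (norm v)\<^sup>2)"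
  unfolding cmod_power2 by (simp add: power2_eq_square algebra_simps)

lemma norm_blaschke_less:
  fixes a :: real and v :: complex
  assumes "\<bar>a\<bar> < 1"
  shows "norm v < 1 \<Longrightarrow> norm (v - of_real a) < norm (1 - of_real a * v)"
    and "norm v > 1 \<Longrightarrow> norm (1 - of_real a * v) < norm (v - of_real a)"
proof -
  have a: "1 - a\<^sup>2 > 0"
    using assms by (simp add: abs_square_less_1)
  show "norm (v - of_real a) < norm (1 - of_real a * v)" if "norm v < 1"
  proof (rule power2_less_imp_less)
    have "(1 - a\<^sup>2) * (1 - (norm v)\<^sup>2) > 0"
      using a that by (simp add: abs_square_less_1)
    then show "(norm (v - of_real a))\<^sup>2 < (norm (1 - of_real a * v))\<^sup>2"
      using norm_blaschke_diff[of a v] by linarith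
  qed simp
  show "norm (1 - of_real a * v) < norm (v - of_real a)" if "norm v > 1"
  proof (rule power2_less_imp_less)
    have "(1 - a\<^sup>2) * (1 - (norm v)\<^sup>2) < 0"
      using a that by (simp add: mult_pos_neg one_less_power)
    then show "(norm (1 - of_real a * v))\<^sup>2 < (norm (v - of_real a))\<^sup>2"
      using norm_blaschke_diff[of a v] by linarith
  qed simp
qed

text \<open>Off the unit circle both factors compare in the same direction, and
  \<open>norm v ^ k\<close> can only widen the gap.\<close>

lemma unit_circle_if_blaschke_products_eq:
  fixes a b :: real and v :: complex
  assumes "\<bar>a\<bar> < 1" "\<bar>b\<bar> < 1"
    and eq: "(1 - of_real a * v) * (1 - of_real b * v) =
          v ^ k * ((v - of_real a) * (v - of_real b))"
  shows "norm v = 1"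
proof (rule ccontr)
  define A A' B B' where "A = norm (1 - of_real a * v)" and "A' = norm (v - of_real a)"
    and "B = norm (1 - of_real b * v)" and "B' = norm (v - of_real b)"
  have eq': "A * B = norm v ^ k * (A' * B')"
    using arg_cong[OF eq, of norm] by (simp add: A_def A'_def B_def B'_def norm_mult norm_power)
  have nonneg: "A \<ge> 0" "A' \<ge> 0" "B \<ge> 0" "B' \<ge> 0"
    by (simp_all add: A_def A'_def B_def B'_def)
  assume "norm v \<noteq> 1"
  then consider "norm v < 1" | "norm v > 1"
    by linarith
  then show False
  proof cases
    case 1
    have "A' * B' < A * B"
      using norm_blaschke_less(1)[OF assms(1) 1] norm_blaschke_less(1)[OF assms(2) 1] nonneg
      by (intro mult_strict_mono') (auto simp: A_def A'_def B_def B'_def)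
    moreover have "norm v ^ k * (A' * B') \<le> 1 * (A' * B')"
      using 1 nonneg by (intro mult_right_mono power_le_one) auto
    ultimately show False
      using eq' by linarith
  next
    case 2
    have "A * B < A' * B'"
      using norm_blaschke_less(2)[OF assms(1) 2] norm_blaschke_less(2)[OF assms(2) 2] nonneg
      by (intro mult_strict_mono') (auto simp: A_def A'_def B_def B'_def)
    moreover have "1 * (A' * B') \<le> norm v ^ k * (A' * B')"
      using 2 nonneg by (intro mult_right_mono one_le_power) auto
    ultimately show False
      using eq' by linarith
  qed
qed

lemma local_poly_root_norm:
  fixes q c :: real and u :: complex
  assumes "q > 1" "\<bar>c\<bar> \<le> 1" "n \<ge> 1"
    and root: "poly (local_poly (of_real q) (of_real c) n) u = 0"
  shows "norm u = 1 / sqrt q"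
proof -
  define r where "r = sqrt q"
  have r: "r > 1" and rr: "r * r = q"
    using assms(1) by (simp_all add: r_def)
  define R where "R = (of_real r :: complex)"
  define C where "C = (of_real c :: complex)"
  define v where "v = R * u"
  have R: "R \<noteq> 0" "of_real q = R * R"
    using r by (simp_all add: R_def flip: rr)
  have "(1 - u) * (1 - C * u) = (R * R * u\<^sup>2) ^ n / (R * R) * (1 - R * R * u) * (C - R * R * u)"
    using local_poly_times_denominator[of "of_real q" n u "of_real c"] root assms R
    by (simp add: C_def)
  also have "R * R * u\<^sup>2 = v\<^sup>2"
    by (simp add: v_def power2_eq_square)
  \<comment> \<open>The denominator gives one \<open>R\<close> to each linear factor, and the two
    sign changes cancel.\<close>
  also have "(v\<^sup>2) ^ n / (R * R) * (1 - R * R * u) * (C - R * R * u)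
      = v ^ (2 * n) * ((v - 1 / R) * (v - C / R))"
    unfolding power_mult[symmetric] using R(1) by (simp add: v_def field_simps)
  finally have "(1 - of_real (1 / r) * v) * (1 - of_real (c / r) * v)
      = v ^ (2 * n) * ((v - of_real (1 / r)) * (v - of_real (c / r)))"
    using R(1) by (simp add: v_def R_def C_def)
  then have "norm v = 1"
    using r assms(2) by (intro unit_circle_if_blaschke_products_eq[of "1 / r" "c / r"]) auto
  then show ?thesis
    using r by (simp add: v_def R_def norm_mult field_simps flip: r_def)
qed

section \<open>The local factor as a function of \<open>s\<close>\<close>

text \<open>The denominator is entire and equals \<open>1 - p\<close> at 0, hence does not vanish
  identically, so its zeros are isolated.\<close>

lemma eventually_one_minus_powr_nonzero:
  fixes p :: nat and z :: complex
  assumes "p > 1"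
  shows "eventually (\<lambda>s. 1 - of_nat p powr (1 - 2 * s) \<noteq> (0 :: complex)) (at z)"
proof -
  define g where "g = (\<lambda>s :: complex. 1 - of_nat p powr (1 - 2 * s) :: complex)"
  have hol: "g holomorphic_on UNIV"
    unfolding g_def using assms by (intro holomorphic_intros) auto
  have "g 0 \<noteq> 0"
    using assms by (simp add: g_def)
  have "eventually (\<lambda>s. g s \<noteq> 0) (at z)"
  proof (cases "g z = 0")
    case True
    from isolated_zeros[OF hol _ _ _ True _ \<open>g 0 \<noteq> 0\<close>]
    obtain r where r: "r > 0" "\<And>w. w \<in> ball z r - {z} \<Longrightarrow> g w \<noteq> 0"
      by auto
    then show ?thesis
      unfolding eventually_at by (intro exI[of _ r]) (auto simp: dist_commute)
  next
    case False
    have "isCont g z"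
      using holomorphic_on_imp_continuous_on[OF hol] by (simp add: continuous_on_eq_continuous_at)
    then show ?thesis
      using False by (intro tendsto_imp_eventually_ne) (auto simp: isCont_def)
  qed
  then show ?thesis
    by (simp add: g_def)
qed

theorem mainTheorem1:
  fixes K :: "'a :: field_char_0 itself" and f p :: nat
  assumes "quadratic_field K"
    and "f \<ge> 1" and "prime p" and "p dvd f"
  shows
    "(\<exists>P :: complex poly. degree P = 2 * multiplicity p f \<and>
        (\<forall>s. 1 - of_nat p powr (1 - 2 * s) \<noteq> 0 \<longrightarrow>
             eps_quotient K f p s = poly P (of_nat p powr (-s))) \<and>
        (\<forall>s. eps K f p s = poly P (of_nat p powr (-s)))) \<and>
     (\<forall>s. eps K f p (1 - s) =
        of_nat p powr (- of_nat (multiplicity p f) * (1 - 2 * s)) * eps K f p s) \<and>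
     (\<forall>s. eps K f p s = 0 \<longrightarrow> Re s = 1 / 2)"
proof -
  define n where "n = multiplicity p f"
  define k where "k = quadratic_character K (int p)"
  define P where "P = local_poly (of_nat p) (of_int k) n"
  define q where "q = (of_nat p :: complex)"
  define u where "u = (\<lambda>s. q powr (-s))"
  have p: "p > 1"
    using assms(3) by (rule prime_gt_1_nat)
  then have q0: "q \<noteq> 0"
    by (simp add: q_def)
  have n: "n \<ge> 1"
    unfolding n_def using assms p by (intro multiplicity_geI) auto
  have k: "k \<in> {-1, 0, 1}"
    unfolding k_def quadratic_character_def kronecker_of_prime[OF assms(3)]
    by (rule kronecker_prime_cases)
  have u0: "u s \<noteq> 0" for s
    using q0 by (simp add: u_def)
  have pow0: "q powr (-s) = u s" for s
    by (simp add: u_def)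
  have pow1: "q powr (1 - s) = q * u s" for s
    using q0 by (simp add: u_def powr_diff powr_minus divide_inverse)
  have pow2: "q powr (1 - 2 * s) = q * (u s)\<^sup>2" for s
    using powr_add[of q "1 - s" "-s"] pow1[of s] by (simp add: u_def power2_eq_square)
  \<comment> \<open>Serves both the power in the numerator and the factor in the functional
    equation.\<close>
  have pow3: "q powr (of_nat n * (1 - 2 * s)) = (q * (u s)\<^sup>2) ^ n" for s
    unfolding pow2[symmetric] using q0 by (simp add: powr_def exp_of_nat_mult[symmetric] mult_ac)
  have pow4: "q powr (of_nat n - 1 - 2 * of_nat n * s) = (q * (u s)\<^sup>2) ^ n / q" for s
  proof -
    have "of_nat n - 1 - 2 * of_nat n * s = of_nat n * (1 - 2 * s) - 1"
      by (simp add: algebra_simps)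
    then show ?thesis
      unfolding pow3[symmetric] using q0 by (simp only: powr_diff powr_to_1)
  qed
  have quot: "eps_quotient K f p s = poly P (u s)" if "1 - q powr (1 - 2 * s) \<noteq> 0" for s
  proof -
    have "eps_quotient K f p s = ((1 - u s) * (1 - of_int k * u s)
        - (q * (u s)\<^sup>2) ^ n / q * (1 - q * u s) * (of_int k - q * u s)) / (1 - q * (u s)\<^sup>2)"
      by (simp only: eps_quotient_def Let_def n_def[symmetric] k_def[symmetric] q_def[symmetric]
          pow0 pow1[of s] pow2[of s] pow4)
    also have "\<dots> = poly P (u s)"
      using that unfolding local_poly_times_denominator[OF q0 n, symmetric] pow2
      by (simp add: P_def q_def)
    finally show ?thesis .
  qed
  \<comment> \<open>The quotient agrees with an entire function on a punctured neighbourhood of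
    \<open>s\<close>, so its junk value at a zero of the denominator never enters.\<close>
  have eps: "eps K f p s = poly P (u s)" for s
  proof -
    have "eventually (\<lambda>w. eps_quotient K f p w = poly P (u w)) (at s)"
      using eventually_one_minus_powr_nonzero[OF p, of s]
      by eventually_elim (rule quot, simp add: q_def)
    then have "eps K f p s = remove_sings (\<lambda>w. poly P (u w)) s"
      unfolding eps_def by (rule remove_sings_cong) simp
    also have "\<dots> = poly P (u s)"
    proof (rule remove_sings_at_analytic)
      have "(\<lambda>w. poly P (u w)) holomorphic_on UNIV"
        using q0 unfolding u_def by (intro holomorphic_intros)
      then show "(\<lambda>w. poly P (u w)) analytic_on {s}"
        by (rule holomorphic_on_imp_analytic_at) auto
    qed
    finally show ?thesis .
  qed
  have deg: "degree P = 2 * n"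
    unfolding P_def using q0 n by (intro degree_local_poly) (simp_all add: q_def)
  have feq: "eps K f p (1 - s) = q powr (- of_nat n * (1 - 2 * s)) * eps K f p s" for s
  proof -
    have "u (1 - s) * q powr (1 - s) = 1"
      using q0 by (simp add: u_def powr_minus)
    then have "u (1 - s) = 1 / (q * u s)"
      using q0 u0[of s] unfolding pow1 by (simp add: field_simps)
    then have "(q * (u s)\<^sup>2) ^ n * poly P (u (1 - s)) = poly P (u s)"
      using local_poly_reflect[OF q0 u0 n, of s "of_int k"] by (simp add: P_def q_def)
    then have "poly P (u (1 - s)) = inverse ((q * (u s)\<^sup>2) ^ n) * poly P (u s)"
      using q0 u0[of s] by (simp add: field_simps)
    moreover have "q powr (- of_nat n * (1 - 2 * s)) = inverse ((q * (u s)\<^sup>2) ^ n)"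
      unfolding pow3[symmetric] mult_minus_left by (rule powr_minus)
    ultimately show ?thesis
      by (simp only: eps)
  qed
  have zeros: "Re s = 1 / 2" if "eps K f p s = 0" for s
  proof -
    have "poly (local_poly (of_real (real p)) (of_real (of_int k)) n) (u s) = 0"
      using that by (simp add: eps P_def)
    then have "norm (u s) = 1 / sqrt (real p)"
      using p n k by (intro local_poly_root_norm[of _ "of_int k"]) auto
    \<comment> \<open>The modulus of \<open>u s\<close> depends only on \<open>Re s\<close>, so the
      circle of radius \<open>1 / sqrt p\<close> corresponds to the critical line.\<close>
    moreover have "norm (u s) = real p powr (- Re s)"
      using p norm_powr_real_powr[of q "-s"] by (simp add: u_def q_def)
    moreover have "1 / sqrt (real p) = real p powr (- (1 / 2))"
      using p by (simp add: powr_minus_divide powr_half_sqrt)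
    ultimately have "real p powr (- Re s) = real p powr (- (1 / 2))"
      by simp
    then have "- Re s = - (1 / 2)"
      using p by (subst (asm) powr_inj) auto
    then show ?thesis
      by simp
  qed
  show ?thesis
    using deg quot eps feq zeros unfolding q_def n_def u_def
    by (intro conjI exI[of _ P] allI impI) simp_all
qed

end
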